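(* Let $(\Omega,\mathcal{F},P)$ be a nonatomic probability space (namely $\mathcal{F}$ does not include any $P$-atoms), let $(E,\mathcal{P})=(L^0(\mathcal{F},\mathbb{R}),|\cdot|)$, and let $M=\{x\in E:\text{there exists a positive number }m_x\text{ such that }x>m_x\text{ on }\Omega\}$. Then $M$ is $L^0$-convex, $\mathcal{T}_c$-closed and $\mathcal{T}_c$-open.
   Context: $L^0(\mathcal{F},\mathbb{R})=L^0(\mathcal{F})$ is the algebra of equivalence classes (a.s. equality) of real-valued $\mathcal{F}$-measurable random variables, ordered by a.s. $\le$. "$x>m$ on $\Omega$" means $x(\omega)>m$ for $P$-almost all $\omega\in\Omega$. $L^0_+(\mathcal{F})=\{\xi\in L^0(\mathcal{F}):\xi\ge0\}$, $L^0_{++}(\mathcal{F})=\{\xi\in L^0(\mathcal{F}):\xi>0\text{ on }\Omega\}$. $\mathcal{T}_c$ is the topology on $L^0(\mathcal{F})$ in which a set $G$ is open iff for each $x\in G$ there is $\varepsilon\in L^0_{++}(\mathcal{F})$ with $\{y\in L^0(\mathcal{F}):|y-x|\le\varepsilon\}\subset G$. A subset $M$ is $L^0$-convex if $\xi x+(1-\xi)y\in M$ for all $x,y\in M$ and $\xi\in L^0_+(\mathcal{F})$ with $0\le\xi\le1$. *)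

theory Defs
  imports "HOL-Probability.Probability"
begin

definition atom_of :: "'a measure \<Rightarrow> 'a set \<Rightarrow> bool" where
  "atom_of P A \<longleftrightarrow> A \<in> sets P \<and> measure P A > 0 \<and>
     (\<forall>B\<in>sets P. B \<subseteq> A \<longrightarrow> measure P B = 0 \<or> measure P B = measure P A)"

definition nonatomic :: "'a measure \<Rightarrow> bool" where
  "nonatomic P \<longleftrightarrow> (\<nexists>A. atom_of P A)"

definition ae_eq :: "'a measure \<Rightarrow> (('a \<Rightarrow> real) \<times> ('a \<Rightarrow> real)) set" where
  "ae_eq P = {(f, g). f \<in> borel_measurable P \<and> g \<in> borel_measurable P \<and> (AE w in P. f w = g w)}"

lemma equiv_ae_eq: "equiv (borel_measurable P) (ae_eq P)"
proof (rule equivI)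
  show "ae_eq P \<subseteq> borel_measurable P \<times> borel_measurable P"
    by (auto simp: ae_eq_def)
  show "refl_on (borel_measurable P) (ae_eq P)"
    by (auto simp: refl_on_def ae_eq_def)
  show "sym (ae_eq P)"
    by (auto simp: sym_def ae_eq_def elim: eventually_mono)
  show "trans (ae_eq P)"
    by (rule transI) (auto simp: ae_eq_def elim: eventually_elim2)
qed

definition L0 :: "'a measure \<Rightarrow> ('a \<Rightarrow> real) set set" where
  "L0 P = borel_measurable P // ae_eq P"

definition L0_class :: "'a measure \<Rightarrow> ('a \<Rightarrow> real) \<Rightarrow> ('a \<Rightarrow> real) set" where
  "L0_class P f = ae_eq P `` {f}"

text \<open>The operations and relations below are computed on representatives; independence of the
  choice of representatives is proved after the definitions.\<close>

definition L0_lift :: "'a measure \<Rightarrow> (real \<Rightarrow> real) \<Rightarrow> ('a \<Rightarrow> real) set \<Rightarrow> ('a \<Rightarrow> real) set" where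
  "L0_lift P u X = (\<Union>f\<in>X. L0_class P (\<lambda>w. u (f w)))"

definition L0_lift2 ::
    "'a measure \<Rightarrow> (real \<Rightarrow> real \<Rightarrow> real) \<Rightarrow> ('a \<Rightarrow> real) set \<Rightarrow> ('a \<Rightarrow> real) set \<Rightarrow> ('a \<Rightarrow> real) set" where
  "L0_lift2 P b X Y = (\<Union>f\<in>X. \<Union>g\<in>Y. L0_class P (\<lambda>w. b (f w) (g w)))"

definition L0_const :: "'a measure \<Rightarrow> real \<Rightarrow> ('a \<Rightarrow> real) set" where
  "L0_const P c = L0_class P (\<lambda>_. c)"

definition L0_add where "L0_add P = L0_lift2 P (+)"
definition L0_diff where "L0_diff P = L0_lift2 P (-)"
definition L0_mult where "L0_mult P = L0_lift2 P (*)"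
definition L0_abs where "L0_abs P = L0_lift P abs"

definition L0_le :: "'a measure \<Rightarrow> ('a \<Rightarrow> real) set \<Rightarrow> ('a \<Rightarrow> real) set \<Rightarrow> bool" where
  "L0_le P X Y \<longleftrightarrow> (\<exists>f\<in>X. \<exists>g\<in>Y. AE w in P. f w \<le> g w)"

text \<open>\<open>L0_gt_on P X Y\<close> is ``\<open>X > Y\<close> on \<open>\<Omega>\<close>'', i.e. strict inequality almost everywhere;
  it is not the strict part of \<^const>\<open>L0_le\<close>.\<close>

definition L0_gt_on :: "'a measure \<Rightarrow> ('a \<Rightarrow> real) set \<Rightarrow> ('a \<Rightarrow> real) set \<Rightarrow> bool" where
  "L0_gt_on P X Y \<longleftrightarrow> (\<exists>f\<in>X. \<exists>g\<in>Y. AE w in P. f w > g w)"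

definition L0_plus :: "'a measure \<Rightarrow> ('a \<Rightarrow> real) set set" where
  "L0_plus P = {X \<in> L0 P. L0_le P (L0_const P 0) X}"

definition L0_pp :: "'a measure \<Rightarrow> ('a \<Rightarrow> real) set set" where
  "L0_pp P = {X \<in> L0 P. L0_gt_on P X (L0_const P 0)}"

lemma L0_class_in_L0: "f \<in> borel_measurable P \<Longrightarrow> L0_class P f \<in> L0 P"
  by (simp add: L0_def L0_class_def quotientI)

lemma L0_E:
  assumes "X \<in> L0 P"
  obtains f where "f \<in> borel_measurable P" "X = L0_class P f"
  using assms unfolding L0_def L0_class_def by (rule quotientE)

lemma mem_L0_class_iff:
  "g \<in> L0_class P f \<longleftrightarrow> f \<in> borel_measurable P \<and> g \<in> borel_measurable P \<and> (AE w in P. f w = g w)"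
  by (simp add: L0_class_def ae_eq_def)

lemma L0_class_eq_iff:
  assumes "f \<in> borel_measurable P" "g \<in> borel_measurable P"
  shows "L0_class P f = L0_class P g \<longleftrightarrow> (AE w in P. f w = g w)"
  using eq_equiv_class_iff[OF equiv_ae_eq assms] assms
  by (simp add: L0_class_def ae_eq_def)

lemma L0_lift_class:
  assumes "f \<in> borel_measurable P" "u \<in> borel_measurable borel"
  shows "L0_lift P u (L0_class P f) = L0_class P (\<lambda>w. u (f w))"
proof -
  have "L0_class P (\<lambda>w. u (f' w)) = L0_class P (\<lambda>w. u (f w))" if "f' \<in> L0_class P f" for f'
  proof (subst L0_class_eq_iff)
    show "AE w in P. u (f' w) = u (f w)"
      using that by (auto simp: mem_L0_class_iff elim: eventually_mono)
  qed (use that assms in \<open>auto simp: mem_L0_class_iff intro: measurable_compose\<close>)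
  moreover have "f \<in> L0_class P f"
    using assms by (simp add: mem_L0_class_iff)
  ultimately show ?thesis
    unfolding L0_lift_def by blast
qed

lemma L0_lift2_class:
  assumes "f \<in> borel_measurable P" "g \<in> borel_measurable P"
    and "case_prod b \<in> borel_measurable (borel \<Otimes>\<^sub>M borel)"
  shows "L0_lift2 P b (L0_class P f) (L0_class P g) = L0_class P (\<lambda>w. b (f w) (g w))"
proof -
  have meas: "(\<lambda>w. b (f' w) (g' w)) \<in> borel_measurable P"
    if "f' \<in> borel_measurable P" "g' \<in> borel_measurable P" for f' g'
    using measurable_compose[OF measurable_Pair[OF that] assms(3)] by simp
  have "L0_class P (\<lambda>w. b (f' w) (g' w)) = L0_class P (\<lambda>w. b (f w) (g w))"
    if "f' \<in> L0_class P f" "g' \<in> L0_class P g" for f' g'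
  proof (subst L0_class_eq_iff)
    have "AE w in P. f w = f' w" "AE w in P. g w = g' w"
      using that by (auto simp: mem_L0_class_iff)
    then show "AE w in P. b (f' w) (g' w) = b (f w) (g w)"
      by eventually_elim simp
  qed (use that assms meas in \<open>auto simp: mem_L0_class_iff\<close>)
  moreover have "f \<in> L0_class P f" "g \<in> L0_class P g"
    using assms by (simp_all add: mem_L0_class_iff)
  ultimately show ?thesis
    unfolding L0_lift2_def by blast
qed

lemma L0_add_class:
  assumes "f \<in> borel_measurable P" "g \<in> borel_measurable P"
  shows "L0_add P (L0_class P f) (L0_class P g) = L0_class P (\<lambda>w. f w + g w)"
  unfolding L0_add_def using assms by (rule L0_lift2_class) measurable

lemma L0_diff_class:
  assumes "f \<in> borel_measurable P" "g \<in> borel_measurable P"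
  shows "L0_diff P (L0_class P f) (L0_class P g) = L0_class P (\<lambda>w. f w - g w)"
  unfolding L0_diff_def using assms by (rule L0_lift2_class) measurable

lemma L0_mult_class:
  assumes "f \<in> borel_measurable P" "g \<in> borel_measurable P"
  shows "L0_mult P (L0_class P f) (L0_class P g) = L0_class P (\<lambda>w. f w * g w)"
  unfolding L0_mult_def using assms by (rule L0_lift2_class) measurable

lemma L0_abs_class:
  assumes "f \<in> borel_measurable P"
  shows "L0_abs P (L0_class P f) = L0_class P (\<lambda>w. \<bar>f w\<bar>)"
  unfolding L0_abs_def using assms by (rule L0_lift_class) measurable

lemma L0_le_class:
  assumes "f \<in> borel_measurable P" "g \<in> borel_measurable P"
  shows "L0_le P (L0_class P f) (L0_class P g) \<longleftrightarrow> (AE w in P. f w \<le> g w)"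
proof
  assume "L0_le P (L0_class P f) (L0_class P g)"
  then obtain f' g' where "AE w in P. f w = f' w" "AE w in P. g w = g' w" "AE w in P. f' w \<le> g' w"
    by (auto simp: L0_le_def mem_L0_class_iff)
  then show "AE w in P. f w \<le> g w"
    by eventually_elim simp
next
  assume "AE w in P. f w \<le> g w"
  moreover have "f \<in> L0_class P f" "g \<in> L0_class P g"
    using assms by (simp_all add: mem_L0_class_iff)
  ultimately show "L0_le P (L0_class P f) (L0_class P g)"
    unfolding L0_le_def by blast
qed

lemma L0_gt_on_class:
  assumes "f \<in> borel_measurable P" "g \<in> borel_measurable P"
  shows "L0_gt_on P (L0_class P f) (L0_class P g) \<longleftrightarrow> (AE w in P. f w > g w)"
proof
  assume "L0_gt_on P (L0_class P f) (L0_class P g)"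
  then obtain f' g' where "AE w in P. f w = f' w" "AE w in P. g w = g' w" "AE w in P. f' w > g' w"
    by (auto simp: L0_gt_on_def mem_L0_class_iff)
  then show "AE w in P. f w > g w"
    by eventually_elim simp
next
  assume "AE w in P. f w > g w"
  moreover have "f \<in> L0_class P f" "g \<in> L0_class P g"
    using assms by (simp_all add: mem_L0_class_iff)
  ultimately show "L0_gt_on P (L0_class P f) (L0_class P g)"
    unfolding L0_gt_on_def by blast
qed

definition L0_convex :: "'a measure \<Rightarrow> ('a \<Rightarrow> real) set set \<Rightarrow> bool" where
  "L0_convex P M \<longleftrightarrow> M \<subseteq> L0 P \<and>
     (\<forall>x\<in>M. \<forall>y\<in>M. \<forall>\<xi>\<in>L0_plus P.
        L0_le P (L0_const P 0) \<xi> \<and> L0_le P \<xi> (L0_const P 1) \<longrightarrow>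
        L0_add P (L0_mult P \<xi> x) (L0_mult P (L0_diff P (L0_const P 1) \<xi>) y) \<in> M)"

definition L0_ball :: "'a measure \<Rightarrow> ('a \<Rightarrow> real) set \<Rightarrow> ('a \<Rightarrow> real) set \<Rightarrow> ('a \<Rightarrow> real) set set" where
  "L0_ball P x \<epsilon> = {y \<in> L0 P. L0_le P (L0_abs P (L0_diff P y x)) \<epsilon>}"

definition Tc_open :: "'a measure \<Rightarrow> ('a \<Rightarrow> real) set set \<Rightarrow> bool" where
  "Tc_open P G \<longleftrightarrow> G \<subseteq> L0 P \<and> (\<forall>x\<in>G. \<exists>\<epsilon>\<in>L0_pp P. L0_ball P x \<epsilon> \<subseteq> G)"

definition Tc :: "'a measure \<Rightarrow> ('a \<Rightarrow> real) set topology" where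
  "Tc P = topology (Tc_open P)"

lemma L0_pp_min:
  assumes "\<delta> \<in> L0_pp P" "\<epsilon> \<in> L0_pp P"
  obtains \<eta> where "\<eta> \<in> L0_pp P" "\<And>x. x \<in> L0 P \<Longrightarrow> L0_ball P x \<eta> \<subseteq> L0_ball P x \<delta> \<inter> L0_ball P x \<epsilon>"
proof -
  from assms obtain d e where m[measurable]: "d \<in> borel_measurable P" "e \<in> borel_measurable P"
    and eq: "\<delta> = L0_class P d" "\<epsilon> = L0_class P e"
    unfolding L0_pp_def by (blast elim: L0_E)
  have pos: "AE w in P. d w > 0" "AE w in P. e w > 0"
    using assms by (simp_all add: L0_pp_def eq L0_const_def L0_gt_on_class)
  let ?h = "\<lambda>w. min (d w) (e w)"
  show ?thesis
  proof
    have "AE w in P. ?h w > 0"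
      using pos by eventually_elim simp
    then show "L0_class P ?h \<in> L0_pp P"
      by (simp add: L0_pp_def L0_class_in_L0 L0_const_def L0_gt_on_class)
    fix x assume "x \<in> L0 P"
    then obtain f where [measurable]: "f \<in> borel_measurable P" and x: "x = L0_class P f"
      by (rule L0_E)
    show "L0_ball P x (L0_class P ?h) \<subseteq> L0_ball P x \<delta> \<inter> L0_ball P x \<epsilon>"
    proof
      fix y assume "y \<in> L0_ball P x (L0_class P ?h)"
      then have yL: "y \<in> L0 P" and le: "L0_le P (L0_abs P (L0_diff P y x)) (L0_class P ?h)"
        by (simp_all add: L0_ball_def)
      from yL obtain g where [measurable]: "g \<in> borel_measurable P" and y: "y = L0_class P g"
        by (rule L0_E)
      from le show "y \<in> L0_ball P x \<delta> \<inter> L0_ball P x \<epsilon>"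
        using yL by (simp add: L0_ball_def x y eq L0_diff_class L0_abs_class L0_le_class)
    qed
  qed
qed

lemma istopology_Tc_open: "istopology (Tc_open P)"
  unfolding istopology_def
proof (intro conjI allI impI)
  fix S T assume S: "Tc_open P S" and T: "Tc_open P T"
  show "Tc_open P (S \<inter> T)"
    unfolding Tc_open_def
  proof (intro conjI ballI)
    show "S \<inter> T \<subseteq> L0 P" using S by (auto simp: Tc_open_def)
    fix x assume x: "x \<in> S \<inter> T"
    then obtain \<delta> \<epsilon> where "\<delta> \<in> L0_pp P" "L0_ball P x \<delta> \<subseteq> S" "\<epsilon> \<in> L0_pp P" "L0_ball P x \<epsilon> \<subseteq> T"
      using S T unfolding Tc_open_def by (metis IntE)
    moreover have "x \<in> L0 P" using x S by (auto simp: Tc_open_def)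
    ultimately show "\<exists>\<eta>\<in>L0_pp P. L0_ball P x \<eta> \<subseteq> S \<inter> T"
      by (meson L0_pp_min Int_mono subset_trans)
  qed
next
  fix K assume K: "\<forall>G\<in>K. Tc_open P G"
  show "Tc_open P (\<Union>K)"
    unfolding Tc_open_def
  proof (intro conjI ballI)
    show "\<Union>K \<subseteq> L0 P" using K by (auto simp: Tc_open_def)
    fix x assume "x \<in> \<Union>K"
    then obtain G where "G \<in> K" "x \<in> G" by blast
    then show "\<exists>\<epsilon>\<in>L0_pp P. L0_ball P x \<epsilon> \<subseteq> \<Union>K"
      using K unfolding Tc_open_def by (meson Union_upper subset_trans)
  qed
qed

lemma openin_Tc: "openin (Tc P) G \<longleftrightarrow> Tc_open P G"
  by (simp add: Tc_def topology_inverse' istopology_Tc_open)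

lemma topspace_Tc: "topspace (Tc P) = L0 P"
proof -
  have "L0_const P 1 \<in> L0_pp P"
    by (simp add: L0_pp_def L0_const_def L0_class_in_L0 L0_gt_on_class)
  then have "Tc_open P (L0 P)"
    by (auto simp: Tc_open_def L0_ball_def)
  then show ?thesis
    by (auto simp: topspace_def openin_Tc Tc_open_def)
qed

end

(* Openness of M is witnessed by constant radii. For the complement, let x not be in M. If x > 0
   almost surely, then |y - x| <= x/2 and y > m give x > 2m/3, so the ball of radius x/2 around x
   misses M. Otherwise A = {x <= 0} has positive probability, and nonatomicity yields a positive
   random variable u whose essential infimum over A is 0: it is 1/(1+n), roughly, on the n-th
   difference of a strictly decreasing sequence of events inside A. If |y - x| <= u, then y <= u
   on A, so y is not bounded below by a positive constant. *)
theory Submission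
  imports Defs
begin

text \<open>Since \<open>A\<close> has positive measure, it can only fail to be an atom through a
  subset whose measure is neither 0 nor that of \<open>A\<close>; monotonicity puts this value
  strictly between.\<close>

lemma nonatomic_subset:
  assumes "nonatomic P" "A \<in> sets P" "measure P A > 0" "finite_measure P"
  obtains B where "B \<in> sets P" "B \<subseteq> A" "0 < measure P B" "measure P B < measure P A"
proof -
  interpret finite_measure P by fact
  have "\<not> atom_of P A"
    using assms(1) by (simp add: nonatomic_def)
  then obtain B where "B \<in> sets P" "B \<subseteq> A" "measure P B \<noteq> 0" "measure P B \<noteq> measure P A"
    using assms by (auto simp: atom_of_def)
  moreover have "measure P B \<le> measure P A"
    using \<open>B \<subseteq> A\<close> assms(2) by (rule finite_measure_mono)
  ultimately show thesis
    using that by (simp add: less_le)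
qed

lemma nonatomic_decreasing_sequence:
  assumes "nonatomic P" "A \<in> sets P" "measure P A > 0" "finite_measure P"
  obtains S :: "nat \<Rightarrow> 'a set" where "\<And>n. S n \<in> sets P" "\<And>n. S n \<subseteq> A" "decseq S"
    "\<And>n. measure P (S (Suc n)) < measure P (S n)"
proof -
  \<comment> \<open>Positive measure is part of the invariant so that the splitting lemma can be
    applied again to each \<open>S n\<close>.\<close>
  have "\<exists>S. \<forall>n. (S n \<in> sets P \<and> S n \<subseteq> A \<and> 0 < measure P (S n)) \<and>
      (S (Suc n) \<subseteq> S n \<and> measure P (S (Suc n)) < measure P (S n))"
  proof (rule dependent_nat_choice)
    show "\<exists>B. B \<in> sets P \<and> B \<subseteq> A \<and> 0 < measure P B"
      using assms by blast
    fix B and n :: nat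
    assume B: "B \<in> sets P \<and> B \<subseteq> A \<and> 0 < measure P B"
    then obtain C where "C \<in> sets P" "C \<subseteq> B" "0 < measure P C" "measure P C < measure P B"
      using nonatomic_subset[OF assms(1) _ _ assms(4)] by blast
    then show "\<exists>C. (C \<in> sets P \<and> C \<subseteq> A \<and> 0 < measure P C) \<and> C \<subseteq> B \<and> measure P C < measure P B"
      using B by blast
  qed
  then show thesis
    using that by (metis decseq_SucI)
qed

text \<open>Supplies the radius for the closedness proof: \<open>u\<close> is at most
  \<open>1/(n+1)\<close> on the layer \<open>S n - S (Suc n)\<close>, and every layer is a non-null
  part of \<open>A\<close>.\<close>

lemma nonatomic_positive_vanishing:
  assumes "nonatomic P" "A \<in> sets P" "measure P A > 0" "finite_measure P"
  obtains u :: "'a \<Rightarrow> real" where "u \<in> borel_measurable P" "\<And>w. u w > 0"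
    "\<And>m. m > 0 \<Longrightarrow> \<not> (AE w in P. w \<in> A \<longrightarrow> u w > m)"
proof -
  interpret finite_measure P by fact
  obtain S where S[measurable]: "\<And>n. S n \<in> sets P" and SA: "\<And>n. S n \<subseteq> A" and "decseq S"
    and less: "\<And>n. measure P (S (Suc n)) < measure P (S n)"
    using nonatomic_decreasing_sequence[OF assms] by blast
  \<comment> \<open>On the intersection of all \<open>S n\<close> the \<open>LEAST\<close> is an unspecified natural number; \<open>u\<close> is
    positive there too, so this junk value is harmless.\<close>
  define u :: "'a \<Rightarrow> real" where "u w = inverse (real (Suc (LEAST n. w \<notin> S n)))" for w
  show thesis
  proof
    show "u \<in> borel_measurable P"
      unfolding u_def by measurable
    show "u w > 0" for w
      by (simp add: u_def)
    fix m :: real assume "m > 0"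
    then obtain n where n: "inverse (real (Suc n)) < m"
      using reals_Archimedean by blast
    have le: "u w \<le> m" if "w \<in> S n - S (Suc n)" for w
    proof -
      have "w \<notin> S (LEAST n. w \<notin> S n)"
        by (rule LeastI[of _ "Suc n"]) (use that in auto)
      \<comment> \<open>A least index at most \<open>n\<close> would give, as \<open>S\<close>
        decreases, a set containing \<open>S n\<close> and hence \<open>w\<close>. The index is in
        fact \<open>Suc n\<close>; the weaker bound suffices.\<close>
      then have "n \<le> (LEAST n. w \<notin> S n)"
        using that \<open>decseq S\<close> unfolding decseq_def by (meson DiffD1 linear subsetD)
      then have "u w \<le> inverse (real (Suc n))"
        unfolding u_def by (intro le_imp_inverse_le) auto
      then show ?thesis
        using n by simp
    qed
    have "S (Suc n) \<subseteq> S n"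
      using \<open>decseq S\<close> by (simp add: decseq_Suc_iff)
    then have "measure P (S n - S (Suc n)) = measure P (S n) - measure P (S (Suc n))"
      by (intro finite_measure_Diff) auto
    then have pos: "measure P (S n - S (Suc n)) > 0"
      using less[of n] by simp
    show "\<not> (AE w in P. w \<in> A \<longrightarrow> u w > m)"
    proof
      assume "AE w in P. w \<in> A \<longrightarrow> u w > m"
      \<comment> \<open>The layer lies in \<open>A\<close> and \<open>u\<close> is at most
        \<open>m\<close> on it, so the assumed bound makes the layer null.\<close>
      then have "AE w in P. w \<notin> S n - S (Suc n)"
        by eventually_elim (use le SA in force)
      then have "S n - S (Suc n) \<in> null_sets P"
        by (subst AE_iff_null_sets) auto
      then show False
        using pos by (simp add: null_sets_def measure_def)
    qed
  qed
qed

lemma L0_ball_class: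
  assumes "f \<in> borel_measurable P" "g \<in> borel_measurable P" "e \<in> borel_measurable P"
  shows "L0_class P g \<in> L0_ball P (L0_class P f) (L0_class P e)
    \<longleftrightarrow> (AE w in P. \<bar>g w - f w\<bar> \<le> e w)"
  using assms by (simp add: L0_ball_def L0_class_in_L0 L0_diff_class L0_abs_class L0_le_class)

lemma L0_pp_class:
  assumes "e \<in> borel_measurable P"
  shows "L0_class P e \<in> L0_pp P \<longleftrightarrow> (AE w in P. e w > 0)"
  using assms by (simp add: L0_pp_def L0_class_in_L0 L0_const_def L0_gt_on_class)

text \<open>Moves openness from classes to representatives, so that only almost-everywhere
  inequalities between measurable functions remain to be checked.\<close>

lemma Tc_openI:
  assumes "G \<subseteq> L0 P"
    and "\<And>f. f \<in> borel_measurable P \<Longrightarrow> L0_class P f \<in> G \<Longrightarrow>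
      \<exists>e\<in>borel_measurable P. (AE w in P. e w > 0) \<and>
        (\<forall>g\<in>borel_measurable P. (AE w in P. \<bar>g w - f w\<bar> \<le> e w) \<longrightarrow> L0_class P g \<in> G)"
  shows "Tc_open P G"
  unfolding Tc_open_def
proof (intro conjI ballI)
  fix x assume "x \<in> G"
  then obtain f where f: "f \<in> borel_measurable P" and x: "x = L0_class P f"
    using assms(1) by (blast elim: L0_E)
  then obtain e where e: "e \<in> borel_measurable P" "AE w in P. e w > 0"
    and sub: "\<And>g. g \<in> borel_measurable P \<Longrightarrow> AE w in P. \<bar>g w - f w\<bar> \<le> e w \<Longrightarrow> L0_class P g \<in> G"
    using assms(2) \<open>x \<in> G\<close> by blast
  have "L0_ball P x (L0_class P e) \<subseteq> G"
  proof
    fix y assume y: "y \<in> L0_ball P x (L0_class P e)"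
    then have "y \<in> L0 P"
      by (simp add: L0_ball_def)
    then obtain g where "g \<in> borel_measurable P" "y = L0_class P g"
      by (rule L0_E)
    then show "y \<in> G"
      using y sub f e by (simp add: x L0_ball_class)
  qed
  then show "\<exists>\<epsilon>\<in>L0_pp P. L0_ball P x \<epsilon> \<subseteq> G"
    using e by (auto simp: L0_pp_class)
qed (fact assms(1))

definition L0_bounded_away :: "'a measure \<Rightarrow> ('a \<Rightarrow> real) set set" where
  "L0_bounded_away P = {x \<in> L0 P. \<exists>m::real. m > 0 \<and> L0_gt_on P x (L0_const P m)}"

lemma L0_class_bounded_away:
  assumes "f \<in> borel_measurable P"
  shows "L0_class P f \<in> L0_bounded_away P \<longleftrightarrow> (\<exists>m>0. AE w in P. f w > m)"
  using assms by (simp add: L0_bounded_away_def L0_class_in_L0 L0_const_def L0_gt_on_class)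

text \<open>A pointwise convex combination of a value above \<open>m\<close> and a value above
  \<open>n\<close> exceeds \<open>min m n\<close>, a positive constant.\<close>

lemma L0_convex_bounded_away: "L0_convex P (L0_bounded_away P)"
  unfolding L0_convex_def
proof (intro conjI ballI impI)
  show "L0_bounded_away P \<subseteq> L0 P"
    by (auto simp: L0_bounded_away_def)
  fix x y \<xi>
  assume x: "x \<in> L0_bounded_away P" and y: "y \<in> L0_bounded_away P" and xi: "\<xi> \<in> L0_plus P"
    and le: "L0_le P (L0_const P 0) \<xi> \<and> L0_le P \<xi> (L0_const P 1)"
  have "x \<in> L0 P" "y \<in> L0 P" "\<xi> \<in> L0 P"
    using x y xi by (simp_all add: L0_bounded_away_def L0_plus_def)
  then obtain f g h where [measurable]:
      "f \<in> borel_measurable P" "g \<in> borel_measurable P" "h \<in> borel_measurable P"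
    and eq: "x = L0_class P f" "y = L0_class P g" "\<xi> = L0_class P h"
    by (elim L0_E)
  obtain m n where "m > 0" "n > 0" and gt: "AE w in P. f w > m" "AE w in P. g w > n"
    using x y by (auto simp: eq L0_class_bounded_away)
  have "AE w in P. 0 \<le> h w" "AE w in P. h w \<le> 1"
    using le by (simp_all add: eq L0_const_def L0_le_class)
  with gt have "AE w in P. h w * f w + (1 - h w) * g w > min m n"
  proof eventually_elim
    case (elim w)
    \<comment> \<open>\<open>convex_bound_lt\<close> bounds convex combinations from above, hence
      the negation.\<close>
    then have "- (h w * f w + (1 - h w) * g w) < - min m n"
      using convex_bound_lt[of "- f w" "- min m n" "- g w" "h w" "1 - h w"] by simp
    then show ?case
      by simp
  qed
  moreover have "min m n > 0"
    using \<open>m > 0\<close> \<open>n > 0\<close> by simp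
  ultimately have "\<exists>k>0. AE w in P. h w * f w + (1 - h w) * g w > k"
    by blast
  then show
    "L0_add P (L0_mult P \<xi> x) (L0_mult P (L0_diff P (L0_const P 1) \<xi>) y) \<in> L0_bounded_away P"
    by (simp add: eq L0_const_def L0_diff_class L0_mult_class L0_add_class L0_class_bounded_away)
qed

lemma openin_bounded_away: "openin (Tc P) (L0_bounded_away P)"
  unfolding openin_Tc
proof (rule Tc_openI)
  show "L0_bounded_away P \<subseteq> L0 P"
    by (auto simp: L0_bounded_away_def)
  fix f assume "f \<in> borel_measurable P" "L0_class P f \<in> L0_bounded_away P"
  then obtain m where "m > 0" and f: "AE w in P. f w > m"
    by (auto simp: L0_class_bounded_away)
  \<comment> \<open>Moving by at most half of the lower bound \<open>m\<close> leaves the other half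
    as a lower bound for \<open>g\<close>.\<close>
  have "L0_class P g \<in> L0_bounded_away P"
    if g: "g \<in> borel_measurable P" "AE w in P. \<bar>g w - f w\<bar> \<le> m / 2" for g
  proof -
    from g(2) f have "AE w in P. g w > m / 2"
      by eventually_elim linarith
    then show ?thesis
      unfolding L0_class_bounded_away[OF g(1)] using \<open>m > 0\<close> half_gt_zero by blast
  qed
  then show "\<exists>e\<in>borel_measurable P. (AE w in P. e w > 0) \<and>
      (\<forall>g\<in>borel_measurable P. (AE w in P. \<bar>g w - f w\<bar> \<le> e w) \<longrightarrow> L0_class P g \<in> L0_bounded_away P)"
    using \<open>m > 0\<close> by (intro bexI[of _ "\<lambda>_. m / 2"]) auto
qed

lemma closedin_bounded_away:
  assumes "nonatomic P" "finite_measure P"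
  shows "closedin (Tc P) (L0_bounded_away P)"
  unfolding closedin_def topspace_Tc openin_Tc
proof
  interpret finite_measure P by fact
  show "L0_bounded_away P \<subseteq> L0 P"
    by (auto simp: L0_bounded_away_def)
  show "Tc_open P (L0 P - L0_bounded_away P)"
  proof (rule Tc_openI)
    fix f assume f[measurable]: "f \<in> borel_measurable P"
      and "L0_class P f \<in> L0 P - L0_bounded_away P"
    then have nf: "\<not> (AE w in P. f w > m)" if "m > 0" for m
      using that L0_class_bounded_away[OF f, THEN iffD2] by blast
    \<comment> \<open>The constant \<open>m\<close> depends on \<open>g\<close>, so a single radius
      \<open>e\<close> must exclude all positive \<open>m\<close> at once.\<close>
    have "\<exists>e\<in>borel_measurable P. (AE w in P. e w > 0) \<and>
        (\<forall>g m. m > 0 \<longrightarrow> (AE w in P. g w > m) \<longrightarrow> \<not> (AE w in P. \<bar>g w - f w\<bar> \<le> e w))"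
    proof (cases "AE w in P. f w > 0")
      case True
      have "\<not> (AE w in P. \<bar>g w - f w\<bar> \<le> f w / 2)" if "m > 0" "AE w in P. g w > m" for g m
      proof
        assume "AE w in P. \<bar>g w - f w\<bar> \<le> f w / 2"
        with that(2) have "AE w in P. f w > 2 * m / 3"
          \<comment> \<open>Here \<open>m < g w\<close> and \<open>g w\<close> is at most
            \<open>3/2 * f w\<close>.\<close>
          by eventually_elim linarith
        moreover have "2 * m / 3 > 0"
          using that(1) by simp
        ultimately show False
          using nf[of "2 * m / 3"] by simp
      qed
      then show ?thesis
        using True by (intro bexI[of _ "\<lambda>w. f w / 2"]) auto
    next
      case False
      \<comment> \<open>If \<open>f\<close> vanishes on \<open>A\<close> and is bounded away from 0
        elsewhere, every ball of constant radius meets the bounded-away set, so the radius must have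
        essential infimum 0 on \<open>A\<close>. This is where nonatomicity enters.\<close>
      define A where "A = {w \<in> space P. \<not> f w > 0}"
      have A: "A \<in> sets P"
        unfolding A_def by measurable
      have "emeasure P A \<noteq> 0"
        using False AE_iff_measurable[OF A A_def[symmetric]] by simp
      then have "measure P A > 0"
        by (simp add: emeasure_eq_measure zero_less_measure_iff)
      then obtain u :: "'a \<Rightarrow> real" where u: "u \<in> borel_measurable P" "\<And>w. u w > 0"
        and van: "\<And>m. m > 0 \<Longrightarrow> \<not> (AE w in P. w \<in> A \<longrightarrow> u w > m)"
        using nonatomic_positive_vanishing[OF assms(1) A _ assms(2)] by blast
      have "\<not> (AE w in P. \<bar>g w - f w\<bar> \<le> u w)" if "m > 0" "AE w in P. g w > m" for g m
      proof
        assume "AE w in P. \<bar>g w - f w\<bar> \<le> u w"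
        \<comment> \<open>On \<open>A\<close>, \<open>f\<close> is nonpositive, hence
          \<open>m < g w \<le> f w + u w \<le> u w\<close>.\<close>
        with that(2) have "AE w in P. w \<in> A \<longrightarrow> u w > m"
          by eventually_elim (auto simp: A_def)
        then show False
          using van that(1) by blast
      qed
      then show ?thesis
        using u by (intro bexI[of _ u]) auto
    qed
    then obtain e where e: "e \<in> borel_measurable P" "AE w in P. e w > 0"
      and far: "\<And>g m. m > 0 \<Longrightarrow> AE w in P. g w > m \<Longrightarrow> \<not> (AE w in P. \<bar>g w - f w\<bar> \<le> e w)"
      by auto
    have "L0_class P g \<in> L0 P - L0_bounded_away P"
      if g: "g \<in> borel_measurable P" "AE w in P. \<bar>g w - f w\<bar> \<le> e w" for g
    proof
      show "L0_class P g \<notin> L0_bounded_away P"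
        unfolding L0_class_bounded_away[OF g(1)] using far g(2) by auto
    qed (rule L0_class_in_L0[OF g(1)])
    then show "\<exists>e\<in>borel_measurable P. (AE w in P. e w > 0) \<and>
        (\<forall>g\<in>borel_measurable P. (AE w in P. \<bar>g w - f w\<bar> \<le> e w) \<longrightarrow>
          L0_class P g \<in> L0 P - L0_bounded_away P)"
      using e by (intro bexI[of _ e]) auto
  qed simp
qed

theorem claim4p12:
  fixes P :: "'a measure" and M :: "('a \<Rightarrow> real) set set"
  assumes "prob_space P"
    and "nonatomic P"
    and "M = {x \<in> L0 P. \<exists>m::real. m > 0 \<and> L0_gt_on P x (L0_const P m)}"
  shows "L0_convex P M \<and> closedin (Tc P) M \<and> openin (Tc P) M"
proof -
  have "M = L0_bounded_away P"
    by (simp add: assms(3) L0_bounded_away_def)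
  moreover have "finite_measure P"
    using assms(1) by (rule prob_space.axioms)
  ultimately show ?thesis
    using L0_convex_bounded_away closedin_bounded_away[OF assms(2)] openin_bounded_away by metis
qed

end
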